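(* Let $f:\mathbb{R}^n\to\mathbb{R}$ be a strictly convex quadratic function with minimizer $x^*$ and denote $H:=\nabla^2 f(x^* )$. Let $\overline{m}$ be an upper bound for the eigenvalues of $H$ and let $\underline{m}>0$ be a lower bound for the eigenvalues of $H$, and set $\kappa:=\overline{m}/\underline{m}$ (so that $\kappa$ is an upper bound for the condition number of $H$). Assume that $\kappa\ge 28$. In the Heavy Ball Method (HBM) let $\alpha=2/\overline{m}$ and $\beta=\left(1-\sqrt{2/\kappa}\right)^2$, and let $0<\epsilon\le 1/\kappa$ be given. Then, for any $x^0\in\mathbb{R}^n$, after $$k=1+\left\lceil \sqrt{2\kappa}\,\ln\left(\tfrac{2}{\epsilon}\right)\right\rceil$$ steps of (HBM) started at $x^0$, the point $\bar x^k:=\tfrac12(x^{k-1}+x^k)$ satisfies $$\|\bar x^k-x^*\|_2\le \epsilon\,\|x^0-x^*\|_2 .$$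
   Context: The Heavy Ball Method (HBM) with step length $\alpha>0$ and momentum parameter $\beta\in[0,1)$, applied to a differentiable function $f:\mathbb{R}^n\to\mathbb{R}$ with starting point $x^0\in\mathbb{R}^n$, is defined as follows: set $x^{-1}:=x^0$ and for $k\ge 0$ let $$x^{k+1}=x^k-\alpha\nabla f(x^k)+\beta(x^k-x^{k-1}).$$ "After $k$ steps" means that the iterates $x^1,\dots,x^k$ have been generated. $\|\cdot\|_2$ is the Euclidean norm, $\ln$ is the natural logarithm, and the condition number of the symmetric positive definite matrix $H$ is the ratio of its largest to its smallest eigenvalue. The quantity $\kappa$ is denoted $\overline{\mathrm{cond}}(H)$ in the source. *)

theory Defs
  imports "HOL-Analysis.Analysis"
begin

definition strictly_convex_on :: "'a::real_vector set \<Rightarrow> ('a \<Rightarrow> real) \<Rightarrow> bool" where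
  "strictly_convex_on S f \<longleftrightarrow> convex S \<and>
     (\<forall>t x y. 0 < t \<longrightarrow> t < 1 \<longrightarrow> x \<in> S \<longrightarrow> y \<in> S \<longrightarrow> x \<noteq> y \<longrightarrow>
        f ((1 - t) *\<^sub>R x + t *\<^sub>R y) < (1 - t) * f x + t * f y)"

text \<open>Polynomials of degree at most two; the matrix need not be symmetric.
  Degree one and zero are ruled out by strict convexity where it is assumed.\<close>

definition quadratic_function :: "(real^'n \<Rightarrow> real) \<Rightarrow> bool" where
  "quadratic_function f \<longleftrightarrow>
     (\<exists>(A :: real^'n^'n) b c. \<forall>x. f x = x \<bullet> (A *v x) + b \<bullet> x + c)"

definition grad :: "('a::real_inner \<Rightarrow> real) \<Rightarrow> 'a \<Rightarrow> 'a" where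
  "grad f x = (THE D. GDERIV f x :> D)"

definition hessian :: "(real^'n \<Rightarrow> real) \<Rightarrow> real^'n \<Rightarrow> real^'n^'n" where
  "hessian f x = jacobian (grad f) (at x)"

definition eigenvalue :: "real^'n^'n \<Rightarrow> real \<Rightarrow> bool" where
  "eigenvalue A l \<longleftrightarrow> (\<exists>v. v \<noteq> 0 \<and> A *v v = l *\<^sub>R v)"

text \<open>In the recursion, truncated subtraction makes the predecessor of index \<open>0\<close> equal
  to \<open>0\<close>, which is exactly the convention that the iterate with index \<open>-1\<close> is the
  starting point.\<close>

fun heavy_ball :: "real \<Rightarrow> real \<Rightarrow> ('a::real_inner \<Rightarrow> real) \<Rightarrow> 'a \<Rightarrow> nat \<Rightarrow> 'a" where
  "heavy_ball \<alpha> \<beta> f x0 0 = x0"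
| "heavy_ball \<alpha> \<beta> f x0 (Suc k) =
     heavy_ball \<alpha> \<beta> f x0 k - \<alpha> *\<^sub>R grad f (heavy_ball \<alpha> \<beta> f x0 k)
     + \<beta> *\<^sub>R (heavy_ball \<alpha> \<beta> f x0 k - heavy_ball \<alpha> \<beta> f x0 (k - 1))"

end

theory Submission
  imports Defs
begin

text \<open>The gradient of \<open>f\<close> is \<open>H (x - x\<^sup>*)\<close> with \<open>H\<close> symmetric, so the error after \<open>k\<close> steps is a
  polynomial \<open>E\<^sub>k\<close> in \<open>H\<close> applied to the initial error, and so is the averaged error
  \<open>(E\<^sub>n + E\<^sub>n\<^sub>+\<^sub>1) / 2\<close>. A polynomial in a self-adjoint operator is self-adjoint, and its norm is the
  largest modulus that it takes on the spectrum; \<open>norm_bound_from_eigenvectors\<close> gives this bound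
  without diagonalising \<open>H\<close>. It remains to treat one eigenvalue \<open>\<lambda>\<close>, that is, the scalar recursion
  with characteristic polynomial \<open>z\<^sup>2 - (1 + \<beta> - s) z + \<beta>\<close>, where \<open>s = \<alpha> \<lambda>\<close>.

  Write \<open>\<beta> = r\<^sup>2\<close> with \<open>r = 1 - q\<close> and \<open>q = sqrt (2 / \<kappa>)\<close>. The choice of \<open>\<alpha>\<close> and \<open>\<beta>\<close> puts \<open>s\<close> between
  \<open>q\<^sup>2 = (1 - r)\<^sup>2\<close> and \<open>2 \<le> (1 + r)\<^sup>2\<close>, so that the roots are \<open>r exp (\<plusminus> \<i> \<theta>)\<close> for a real angle \<open>\<theta>\<close>.
  Hence the scalar iterates are \<open>r ^ k (S\<^sub>k\<^sub>+\<^sub>1 - r S\<^sub>k)\<close> with \<open>S\<^sub>k = sin (k \<theta>) / sin \<theta>\<close>. The factor \<open>S\<^sub>k\<close>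
  can be as large as \<open>k\<close>, because the two roots may coincide. Averaging two consecutive iterates
  damps it: the average is \<open>r ^ n (r cos ((n + 1) \<theta>) + (1 - r\<^sup>2) S\<^sub>n\<^sub>+\<^sub>1 / 2)\<close>, in which the growing term
  carries the factor \<open>1 - r\<^sup>2 \<le> 2 q\<close> (\<open>abs_average_le\<close>).

  For \<open>n = \<lceil>(2 / q) ln (2 / \<epsilon>)\<rceil>\<close> the product \<open>q n\<close> is about \<open>2 ln (2 / \<epsilon>)\<close>. Then \<open>r ^ n\<close> is at most
  \<open>(\<epsilon> / 2)\<^sup>2\<close>, while the other factor is only logarithmic in \<open>1 / \<epsilon>\<close>, at most \<open>4 / \<epsilon>\<close>; their product
  is at most \<open>\<epsilon>\<close> (\<open>decay_at_step_count\<close>).\<close>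

section \<open>Self-adjoint operators\<close>

text \<open>A maximizer \<open>w\<close> of \<open>v \<bullet> A v\<close> on the unit sphere of \<open>S\<close> exists by compactness. It is an
  eigenvector because the residual \<open>g = A w - \<mu> w\<close> is itself an admissible direction of variation:
  moving from \<open>w\<close> along \<open>g\<close> would raise the quotient to first order unless \<open>g = 0\<close>.\<close>

lemma Rayleigh_eigenvector:
  fixes A :: "'a::euclidean_space \<Rightarrow> 'a"
  assumes lin: "linear A" and adj: "\<And>u v. A u \<bullet> v = u \<bullet> A v"
    and S: "subspace S" "\<And>v. v \<in> S \<Longrightarrow> A v \<in> S" "u \<in> S" "u \<noteq> 0"
  obtains w \<mu> where "w \<in> S" "w \<noteq> 0" "A w = \<mu> *\<^sub>R w"
    "\<And>v. v \<in> S \<Longrightarrow> v \<bullet> A v \<le> \<mu> * (v \<bullet> v)"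
proof -
  let ?K = "S \<inter> sphere 0 1"
  have "compact ?K"
    using S(1) by (intro closed_Int_compact closed_subspace) auto
  moreover have "(1 / norm u) *\<^sub>R u \<in> ?K"
    using S by (auto simp: subspace_scale)
  then have "?K \<noteq> {}" by blast
  moreover have "continuous_on ?K (\<lambda>v. v \<bullet> A v)"
    by (intro continuous_intros linear_continuous_on linear_linear[THEN iffD2] lin)
  ultimately obtain w where w: "w \<in> ?K" and max: "\<And>v. v \<in> ?K \<Longrightarrow> v \<bullet> A v \<le> w \<bullet> A w"
    using continuous_attains_sup by metis
  define \<mu> where "\<mu> = w \<bullet> A w"
  have ww: "w \<bullet> w = 1"
    using w by (simp add: norm_eq_1)
  have bound: "v \<bullet> A v \<le> \<mu> * (v \<bullet> v)" if "v \<in> S" for v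
  proof (cases "v = 0")
    case False
    have "((1 / norm v) *\<^sub>R v) \<bullet> A ((1 / norm v) *\<^sub>R v) \<le> \<mu>"
      unfolding \<mu>_def using False that S(1) by (intro max) (auto simp: subspace_scale)
    then have "(v \<bullet> A v) / (norm v)\<^sup>2 \<le> \<mu>"
      by (simp add: linear_scale[OF lin] power2_eq_square)
    then show ?thesis
      using False by (simp add: divide_simps power2_norm_eq_inner)
  qed (simp add: linear_0[OF lin])
  define g where "g = A w - \<mu> *\<^sub>R w"
  define c where "c = \<mu> * (g \<bullet> g) - g \<bullet> A g"
  have gS: "g \<in> S"
    using w S unfolding g_def by (intro subspace_diff subspace_scale) auto
  have c0: "0 \<le> c"
    using bound[OF gS] by (simp add: c_def)
  have vary: "2 * t * (g \<bullet> g) \<le> t\<^sup>2 * c" for t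
  proof -
    have "w + t *\<^sub>R g \<in> S"
      using w gS S(1) by (auto intro: subspace_add subspace_scale)
    note bound[OF this]
    also have "(w + t *\<^sub>R g) \<bullet> (w + t *\<^sub>R g) = 1 + 2 * t * (g \<bullet> w) + t\<^sup>2 * (g \<bullet> g)"
      by (simp add: inner_add_left inner_add_right ww inner_commute power2_eq_square)
    also have "(w + t *\<^sub>R g) \<bullet> A (w + t *\<^sub>R g)
        = \<mu> + 2 * t * (g \<bullet> A w) + t\<^sup>2 * (g \<bullet> A g)"
      using adj[of w g] by (simp add: linear_add[OF lin] linear_scale[OF lin] inner_add_left
          inner_add_right \<mu>_def inner_commute power2_eq_square)
    finally have "2 * t * (g \<bullet> A w - \<mu> * (g \<bullet> w)) \<le> t\<^sup>2 * c"
      by (simp add: c_def algebra_simps)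
    moreover have "g \<bullet> A w - \<mu> * (g \<bullet> w) = g \<bullet> g"
      by (subst (3) g_def) (simp add: inner_diff_right)
    ultimately show ?thesis
      by simp
  qed
  \<comment> \<open>The first-order gain \<open>2 t (g \<bullet> g)\<close> beats the second-order loss \<open>t\<^sup>2 c\<close> for small \<open>t > 0\<close>;
    this \<open>t\<close> is small enough, and it vanishes only if \<open>g\<close> does.\<close>
  define t where "t = (g \<bullet> g) / (c + 1)"
  have gg: "g \<bullet> g = t * (c + 1)"
    using c0 by (simp add: t_def)
  have "t\<^sup>2 * (c + 2) \<le> 0"
    using vary[of t] unfolding gg by (simp add: power2_eq_square algebra_simps)
  then have "t = 0"
    using c0 by (simp add: mult_le_0_iff)
  then have "g = 0"
    using gg by simp
  then have "A w = \<mu> *\<^sub>R w"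
    by (simp add: g_def)
  moreover have "w \<noteq> 0"
    using ww by auto
  ultimately show ?thesis
    using that[of w \<mu>] w bound by blast
qed

text \<open>The norm of \<open>B\<close> is attained on the top eigenspace of \<open>B\<^sup>2\<close>. As \<open>A\<close> commutes with \<open>B\<close>, it maps
  this eigenspace into itself and so has an eigenvector there; the bound on eigenvectors of \<open>A\<close>
  therefore already controls the norm of \<open>B\<close>.\<close>

lemma norm_bound_from_eigenvectors:
  fixes A B :: "'a::euclidean_space \<Rightarrow> 'a"
  assumes A: "linear A" "\<And>u v. A u \<bullet> v = u \<bullet> A v"
    and B: "linear B" "\<And>u v. B u \<bullet> v = u \<bullet> B v"
    and comm: "\<And>v. A (B v) = B (A v)"
    and eig: "\<And>w l. w \<noteq> 0 \<Longrightarrow> A w = l *\<^sub>R w \<Longrightarrow> norm (B w) \<le> C * norm w"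
  shows "norm (B v) \<le> C * norm v"
proof (cases "v = 0")
  case False
  have BB: "linear (\<lambda>v. B (B v))"
    using linear_compose[OF B(1) B(1)] by (simp add: o_def)
  obtain w \<mu> where w: "w \<noteq> 0" "B (B w) = \<mu> *\<^sub>R w"
    and \<mu>: "\<And>v. v \<bullet> B (B v) \<le> \<mu> * (v \<bullet> v)"
    using Rayleigh_eigenvector[OF BB, of UNIV v] False B(2) by auto
  have square: "v \<bullet> B (B v) = (norm (B v))\<^sup>2" for v
    by (metis B(2) power2_norm_eq_inner)
  let ?S = "{u. B (B u) = \<mu> *\<^sub>R u}"
  have sub: "subspace ?S"
    by (auto simp: subspace_def linear_add[OF B(1)] linear_scale[OF B(1)] linear_0[OF B(1)]
        scaleR_add_right)
  have inv: "A u \<in> ?S" if "u \<in> ?S" for u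
    using that by (simp flip: comm add: linear_scale[OF A(1)])
  have "w \<in> ?S"
    using w(2) by simp
  then obtain z l where z: "z \<in> ?S" "z \<noteq> 0" "A z = l *\<^sub>R z"
    using Rayleigh_eigenvector[OF A sub inv _ w(1)] by metis
  have "\<mu> * (norm z)\<^sup>2 = (norm (B z))\<^sup>2"
    using z(1) square[of z] by (simp add: power2_norm_eq_inner)
  also have "\<dots> \<le> (C * norm z)\<^sup>2"
    using eig[OF z(2,3)] by (intro power_mono) auto
  finally have "\<mu> \<le> C\<^sup>2"
    using z(2) by (simp add: power_mult_distrib)
  have "0 \<le> C * norm z"
    using eig[OF z(2,3)] norm_ge_zero order_trans by blast
  then have "0 \<le> C"
    using z(2) by (simp add: zero_le_mult_iff)
  have "(norm (B v))\<^sup>2 \<le> \<mu> * (norm v)\<^sup>2"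
    using \<mu>[of v] by (simp add: square power2_norm_eq_inner)
  also have "\<dots> \<le> C\<^sup>2 * (norm v)\<^sup>2"
    using \<open>\<mu> \<le> C\<^sup>2\<close> by (intro mult_right_mono) auto
  also have "\<dots> = (C * norm v)\<^sup>2"
    by (simp add: power_mult_distrib)
  finally show ?thesis
    by (rule power2_le_imp_le) (use \<open>0 \<le> C\<close> in simp)
qed (simp add: linear_0[OF B(1)])

section \<open>The scalar recursion\<close>

text \<open>The quotient \<open>sin (k \<theta>) / sin \<theta>\<close>, that is, the value at \<open>cos \<theta>\<close> of the Chebyshev polynomial of the
  second kind of degree \<open>k - 1\<close>. The recursion is the addition theorem divided by \<open>sin \<theta>\<close>; it also
  covers \<open>sin \<theta> = 0\<close>, the case of a double characteristic root.\<close>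

fun sin_ratio :: "real \<Rightarrow> nat \<Rightarrow> real" where
  "sin_ratio \<theta> 0 = 0"
| "sin_ratio \<theta> (Suc k) = cos \<theta> * sin_ratio \<theta> k + cos (real k * \<theta>)"

lemma sin_mult_sin_ratio: "sin \<theta> * sin_ratio \<theta> k = sin (real k * \<theta>)"
proof (induction k)
  case (Suc k)
  have "sin \<theta> * sin_ratio \<theta> (Suc k)
      = cos \<theta> * (sin \<theta> * sin_ratio \<theta> k) + sin \<theta> * cos (real k * \<theta>)"
    by (simp add: algebra_simps)
  also have "\<dots> = sin (real k * \<theta> + \<theta>)"
    by (simp only: Suc.IH) (simp add: sin_add)
  finally show ?case
    by (simp add: algebra_simps)
qed simp

lemma abs_sin_ratio_le: "\<bar>sin_ratio \<theta> k\<bar> \<le> real k"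
proof (induction k)
  case (Suc k)
  have "\<bar>sin_ratio \<theta> (Suc k)\<bar> \<le> \<bar>cos \<theta>\<bar> * \<bar>sin_ratio \<theta> k\<bar> + \<bar>cos (real k * \<theta>)\<bar>"
    by (simp flip: abs_mult)
  also have "\<dots> \<le> 1 * real k + 1"
    using Suc.IH by (intro add_mono mult_mono) auto
  finally show ?case by simp
qed simp

lemma cos_eq_sin_ratio:
  "cos (real (Suc k) * \<theta>) = cos \<theta> * sin_ratio \<theta> (Suc k) - sin_ratio \<theta> k"
proof -
  have "cos (real (Suc k) * \<theta>) = cos (real k * \<theta> + \<theta>)"
    by (simp add: algebra_simps)
  also have "\<dots> = cos \<theta> * cos (real k * \<theta>) - (sin \<theta>)\<^sup>2 * sin_ratio \<theta> k"
    by (simp add: cos_add power2_eq_square flip: sin_mult_sin_ratio)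
  also have "\<dots> = cos \<theta> * sin_ratio \<theta> (Suc k) - sin_ratio \<theta> k"
    unfolding sin_squared_eq by (simp add: sin_ratio.simps(2) power2_eq_square algebra_simps)
  finally show ?thesis .
qed

lemma sin_ratio_Suc_Suc:
  "sin_ratio \<theta> (Suc (Suc k)) = 2 * cos \<theta> * sin_ratio \<theta> (Suc k) - sin_ratio \<theta> k"
  using cos_eq_sin_ratio[of k \<theta>] by simp

text \<open>Below, the three-term recursion is the useful one, and it has to be applied to \<open>Suc (Suc k)\<close>
  without unfolding \<open>Suc k\<close>.\<close>

declare sin_ratio.simps(2) [simp del]

text \<open>The condition on \<open>s\<close> says that the characteristic roots are \<open>r exp (\<plusminus> \<i> \<theta>)\<close>, so
  \<open>r ^ k * sin_ratio \<theta> k\<close> and its shift solve the recursion; the combination is fixed by the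
  convention that the iterate before \<open>e 0\<close> equals \<open>e 0\<close>.\<close>

lemma recursion_closed_form:
  fixes e :: "nat \<Rightarrow> real"
  assumes rec: "\<And>k. e (Suc k) = e k - s * e k + r\<^sup>2 * (e k - e (k - 1))"
    and s: "2 * r * cos \<theta> = 1 + r\<^sup>2 - s"
  shows "e k = e 0 * r ^ k * (sin_ratio \<theta> (Suc k) - r * sin_ratio \<theta> k)"
proof (induction k rule: less_induct)
  case (less k)
  consider "k = 0" | "k = 1" | j where "k = Suc (Suc j)"
    by (metis One_nat_def not0_implies_Suc)
  then show ?case
  proof cases
    case 1
    then show ?thesis by (simp add: sin_ratio.simps(2))
  next
    case 2
    have "e 1 = e 0 * (1 - s)"
      using rec[of 0] by (simp add: algebra_simps)
    also have "1 - s = 2 * r * cos \<theta> - r\<^sup>2"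
      using s by simp
    finally show ?thesis
      using 2 by (simp add: sin_ratio.simps(2) power2_eq_square algebra_simps)
  next
    case (3 j)
    have "e k = (2 * r * cos \<theta>) * e (Suc j) - r\<^sup>2 * e j"
      unfolding s using rec[of "Suc j"] 3 by (simp add: algebra_simps)
    then show ?thesis
      using less.IH[of j] less.IH[of "Suc j"] 3
      by (simp add: sin_ratio_Suc_Suc power2_eq_square algebra_simps)
  qed
qed

text \<open>The sum of two consecutive iterates contains \<open>r\<close> times the difference
  \<open>sin_ratio \<theta> (n + 2) - sin_ratio \<theta> n = 2 cos ((n + 1) \<theta>)\<close>, which is bounded although both terms
  may grow linearly. What is left of the linear growth has the small factor \<open>1 - r\<^sup>2\<close>.\<close>

lemma abs_average_le:
  fixes e :: "nat \<Rightarrow> real"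
  assumes rec: "\<And>k. e (Suc k) = e k - s * e k + r\<^sup>2 * (e k - e (k - 1))"
    and r: "0 < r" "r \<le> 1" and s: "(1 - r)\<^sup>2 \<le> s" "s \<le> (1 + r)\<^sup>2"
  shows "\<bar>(e n + e (Suc n)) / 2\<bar> \<le> r ^ n * (r + (1 - r\<^sup>2) * real (Suc n) / 2) * \<bar>e 0\<bar>"
proof -
  define \<theta> where "\<theta> = arccos ((1 + r\<^sup>2 - s) / (2 * r))"
  let ?S = "sin_ratio \<theta>"
  have "cos \<theta> = (1 + r\<^sup>2 - s) / (2 * r)"
    unfolding \<theta>_def using r(1) s
    by (intro cos_arccos) (auto simp: field_simps power2_eq_square)
  then have "2 * r * cos \<theta> = 1 + r\<^sup>2 - s"
    using r(1) by simp
  note closed = recursion_closed_form[of e, OF rec this]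
  have "(e n + e (Suc n)) / 2
      = r ^ n * (r * (cos \<theta> * ?S (Suc n) - ?S n) + (1 - r\<^sup>2) * ?S (Suc n) / 2) * e 0"
    by (simp add: closed[of n] closed[of "Suc n"] sin_ratio_Suc_Suc power2_eq_square field_simps)
  also have "\<dots> = r ^ n * (r * cos (real (Suc n) * \<theta>) + (1 - r\<^sup>2) * ?S (Suc n) / 2) * e 0"
    by (simp only: cos_eq_sin_ratio)
  finally have eq: "(e n + e (Suc n)) / 2 = \<dots>" .
  have r2: "0 \<le> 1 - r\<^sup>2"
    using r by (simp add: power_le_one)
  have "\<bar>r * cos (real (Suc n) * \<theta>) + (1 - r\<^sup>2) * ?S (Suc n) / 2\<bar>
      \<le> r * \<bar>cos (real (Suc n) * \<theta>)\<bar> + (1 - r\<^sup>2) * \<bar>?S (Suc n)\<bar> / 2"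
    by (rule order_trans[OF abs_triangle_ineq]) (use r r2 in \<open>simp add: abs_mult\<close>)
  also have "\<dots> \<le> r * 1 + (1 - r\<^sup>2) * real (Suc n) / 2"
    using r r2 by (intro add_mono mult_left_mono divide_right_mono abs_sin_ratio_le abs_cos_le_one) auto
  finally show ?thesis
    unfolding eq using r by (simp add: abs_mult mult_left_mono mult_right_mono)
qed

text \<open>With \<open>L = ln (2 / \<epsilon>)\<close>, the lower bound \<open>q n \<ge> 2 L\<close> makes the power at most \<open>exp (- 2 L)\<close>, and the
  upper bound \<open>q (n + 1) \<le> 2 L + 2 q\<close> controls the other factor, where \<open>L \<le> 2 / \<epsilon> - 1\<close> suffices.\<close>

lemma decay_at_step_count:
  fixes q \<epsilon> :: real
  assumes q: "0 < q" "q \<le> 1" and \<epsilon>: "0 < \<epsilon>" "\<epsilon> \<le> 1"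
    and n: "n = nat \<lceil>(2 / q) * ln (2 / \<epsilon>)\<rceil>"
  shows "(1 - q) ^ n * ((1 - q) + (1 - (1 - q)\<^sup>2) * real (Suc n) / 2) \<le> \<epsilon>"
proof -
  define L where "L = ln (2 / \<epsilon>)"
  have L: "0 \<le> L" "L \<le> 2 / \<epsilon> - 1"
    unfolding L_def using \<epsilon> by (auto intro: ln_le_minus_one)
  have "0 \<le> (2 / q) * L"
    using L q by simp
  then have lower: "(2 / q) * L \<le> n" and upper: "n \<le> (2 / q) * L + 1"
    unfolding n L_def by linarith+
  have "(1 - q) ^ n \<le> exp (- q) ^ n"
    using q exp_ge_add_one_self[of "- q"] by (intro power_mono) auto
  also have "\<dots> = exp (- (q * n))"
    by (simp flip: exp_of_nat_mult add: mult.commute)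
  also have "\<dots> \<le> exp (- (2 * L))"
    using lower q by (simp add: field_simps)
  also have "\<dots> = (\<epsilon> / 2)\<^sup>2"
    using \<epsilon> by (simp add: L_def exp_minus power2_eq_square exp_double field_simps)
  finally have power: "(1 - q) ^ n \<le> (\<epsilon> / 2)\<^sup>2" .
  have "(1 - (1 - q)\<^sup>2) * real (Suc n) / 2 = q * Suc n - q\<^sup>2 * Suc n / 2"
    by (simp add: power2_eq_square field_simps)
  also have "\<dots> \<le> q * Suc n"
    by simp
  also have "\<dots> \<le> 2 * L + 2 * q"
    using upper q by (simp add: field_simps)
  also have "\<dots> \<le> 2 * (2 / \<epsilon> - 1) + 2 * q"
    using L by simp
  finally have factor: "(1 - q) + (1 - (1 - q)\<^sup>2) * real (Suc n) / 2 \<le> 4 / \<epsilon>"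
    using q by simp
  have "0 \<le> 1 - (1 - q)\<^sup>2"
    using q by (simp add: power_le_one)
  with power factor have "(1 - q) ^ n * ((1 - q) + (1 - (1 - q)\<^sup>2) * real (Suc n) / 2)
      \<le> (\<epsilon> / 2)\<^sup>2 * (4 / \<epsilon>)"
    using q by (intro mult_mono) auto
  also have "\<dots> = \<epsilon>"
    using \<epsilon> by (simp add: power2_eq_square)
  finally show ?thesis .
qed

section \<open>The error propagation operator\<close>

text \<open>The method applied to the gradient field \<open>A\<close>, which vanishes at the origin, as a function of
  the starting point \<open>d\<close>. For linear \<open>A\<close> it is a polynomial in \<open>A\<close>; the lemmas below are the facts
  about such polynomials that the spectral bound requires. At index \<open>0\<close>, truncated subtraction gives
  the convention that the previous iterate is \<open>d\<close>.\<close>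

fun error_iterate :: "real \<Rightarrow> real \<Rightarrow> ('a::real_vector \<Rightarrow> 'a) \<Rightarrow> nat \<Rightarrow> 'a \<Rightarrow> 'a" where
  "error_iterate \<alpha> \<beta> A 0 d = d"
| "error_iterate \<alpha> \<beta> A (Suc k) d =
     error_iterate \<alpha> \<beta> A k d - \<alpha> *\<^sub>R A (error_iterate \<alpha> \<beta> A k d)
     + \<beta> *\<^sub>R (error_iterate \<alpha> \<beta> A k d - error_iterate \<alpha> \<beta> A (k - 1) d)"

lemma linear_error_iterate:
  assumes A: "linear A"
  shows "linear (error_iterate \<alpha> \<beta> A k)"
proof (induction k rule: less_induct)
  case (less k)
  show ?case
  proof (cases k)
    case 0
    then show ?thesis by (simp add: linear_iff)
  next
    case (Suc j)
    have lin: "linear (error_iterate \<alpha> \<beta> A j)" "linear (error_iterate \<alpha> \<beta> A (j - 1))"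
      using less Suc by auto
    have "linear (\<lambda>d. A (error_iterate \<alpha> \<beta> A j d))"
      using linear_compose[OF lin(1) A] by (simp add: o_def)
    with lin show ?thesis
      unfolding Suc error_iterate.simps
      by (intro linear_compose_add linear_compose_sub linear_compose_scale_right)
  qed
qed

lemma error_iterate_commute:
  assumes A: "linear A"
  shows "A (error_iterate \<alpha> \<beta> A k d) = error_iterate \<alpha> \<beta> A k (A d)"
proof (induction k rule: less_induct)
  case (less k)
  show ?case
  proof (cases k)
    case (Suc j)
    have "A (error_iterate \<alpha> \<beta> A j d) = error_iterate \<alpha> \<beta> A j (A d)"
      "A (error_iterate \<alpha> \<beta> A (j - 1) d) = error_iterate \<alpha> \<beta> A (j - 1) (A d)"
      using less Suc by auto
    then show ?thesis
      unfolding Suc error_iterate.simps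
      by (simp add: linear_add[OF A] linear_diff[OF A] linear_scale[OF A])
  qed simp
qed

lemma error_iterate_self_adjoint:
  fixes A :: "'a::real_inner \<Rightarrow> 'a"
  assumes A: "linear A" "\<And>u v. A u \<bullet> v = u \<bullet> A v"
  shows "error_iterate \<alpha> \<beta> A k u \<bullet> v = u \<bullet> error_iterate \<alpha> \<beta> A k v"
proof (induction k arbitrary: u v rule: less_induct)
  case (less k)
  show ?case
  proof (cases k)
    case (Suc j)
    have IH: "error_iterate \<alpha> \<beta> A j u \<bullet> v = u \<bullet> error_iterate \<alpha> \<beta> A j v"
      "error_iterate \<alpha> \<beta> A (j - 1) u \<bullet> v = u \<bullet> error_iterate \<alpha> \<beta> A (j - 1) v"
      "error_iterate \<alpha> \<beta> A j u \<bullet> A v = u \<bullet> error_iterate \<alpha> \<beta> A j (A v)"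
      using less Suc by auto
    then show ?thesis
      unfolding Suc error_iterate.simps
      by (simp add: inner_add_left inner_add_right inner_diff_left inner_diff_right A(2)
          flip: A(2) error_iterate_commute[OF A(1)])
  qed simp
qed

lemma error_iterate_eigenvector:
  assumes A: "linear A" and w: "A w = l *\<^sub>R w"
  shows "error_iterate \<alpha> \<beta> A k w = error_iterate \<alpha> \<beta> ((*) l) k 1 *\<^sub>R w"
proof -
  define e where "e j = error_iterate \<alpha> \<beta> ((*) l) j 1" for j
  have rec: "e (Suc j) = e j - \<alpha> * (l * e j) + \<beta> * (e j - e (j - 1))" for j
    by (simp add: e_def)
  have "error_iterate \<alpha> \<beta> A k w = e k *\<^sub>R w"
  proof (induction k rule: less_induct)
    case (less k)
    show ?case
    proof (cases k)
      case 0
      then show ?thesis by (simp add: e_def)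
    next
      case (Suc j)
      have IH: "error_iterate \<alpha> \<beta> A j w = e j *\<^sub>R w"
        "error_iterate \<alpha> \<beta> A (j - 1) w = e (j - 1) *\<^sub>R w"
        using less Suc by auto
      show ?thesis
        unfolding Suc error_iterate.simps IH rec
        by (simp add: linear_scale[OF A] w algebra_simps)
    qed
  qed
  then show ?thesis
    by (simp add: e_def)
qed

lemma norm_average_error_iterate_le:
  fixes A :: "'a::euclidean_space \<Rightarrow> 'a"
  assumes A: "linear A" "\<And>u v. A u \<bullet> v = u \<bullet> A v"
    and eig: "\<And>w l. w \<noteq> 0 \<Longrightarrow> A w = l *\<^sub>R w \<Longrightarrow> (1 - r)\<^sup>2 \<le> \<alpha> * l \<and> \<alpha> * l \<le> (1 + r)\<^sup>2"
    and r: "0 < r" "r \<le> 1"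
  shows "norm ((1 / 2) *\<^sub>R (error_iterate \<alpha> (r\<^sup>2) A n d + error_iterate \<alpha> (r\<^sup>2) A (Suc n) d))
      \<le> r ^ n * (r + (1 - r\<^sup>2) * real (Suc n) / 2) * norm d"
proof (rule norm_bound_from_eigenvectors[OF A])
  let ?E = "error_iterate \<alpha> (r\<^sup>2) A"
  show "linear (\<lambda>d. (1 / 2) *\<^sub>R (?E n d + ?E (Suc n) d))"
    by (intro linear_compose_scale_right linear_compose_add linear_error_iterate A)
  show "((1 / 2) *\<^sub>R (?E n u + ?E (Suc n) u)) \<bullet> v = u \<bullet> ((1 / 2) *\<^sub>R (?E n v + ?E (Suc n) v))"
    for u v
    using error_iterate_self_adjoint[OF A, of \<alpha> "r\<^sup>2"]
    by (simp add: inner_add_left inner_add_right del: error_iterate.simps)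
  show "A ((1 / 2) *\<^sub>R (?E n v + ?E (Suc n) v)) = (1 / 2) *\<^sub>R (?E n (A v) + ?E (Suc n) (A v))"
    for v
    by (simp add: linear_scale[OF A(1)] linear_add[OF A(1)] error_iterate_commute[OF A(1)]
        del: error_iterate.simps)
  fix w l assume w: "w \<noteq> 0" "A w = l *\<^sub>R w"
  define e where "e k = error_iterate \<alpha> (r\<^sup>2) ((*) l) k 1" for k
  have E: "?E k w = e k *\<^sub>R w" for k
    unfolding e_def by (rule error_iterate_eigenvector[OF A(1) w(2)])
  have "(1 / 2) *\<^sub>R (?E n w + ?E (Suc n) w) = ((e n + e (Suc n)) / 2) *\<^sub>R w"
    unfolding E by (simp add: add_divide_distrib scaleR_add_left scaleR_add_right)
  then have "norm ((1 / 2) *\<^sub>R (?E n w + ?E (Suc n) w)) = \<bar>(e n + e (Suc n)) / 2\<bar> * norm w"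
    by simp
  also have "\<dots> \<le> r ^ n * (r + (1 - r\<^sup>2) * real (Suc n) / 2) * \<bar>e 0\<bar> * norm w"
    using eig[OF w] r
    by (intro mult_right_mono abs_average_le[where s = "\<alpha> * l"]) (auto simp: e_def)
  finally show "norm ((1 / 2) *\<^sub>R (?E n w + ?E (Suc n) w))
      \<le> r ^ n * (r + (1 - r\<^sup>2) * real (Suc n) / 2) * norm w"
    by (simp add: e_def)
qed

section \<open>Quadratic functions\<close>

text \<open>The matrix of a quadratic function need not be symmetric; only its symmetrization
  \<open>A + transpose A\<close>, which is the Hessian, enters the gradient.\<close>

lemma GDERIV_quadratic:
  fixes A :: "real^'n^'n"
  shows "GDERIV (\<lambda>x. x \<bullet> (A *v x) + b \<bullet> x + c) x :> (A + transpose A) *v x + b"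
proof -
  have "((*v) A has_derivative (*v) A) (at x)"
    by (intro linear_imp_has_derivative) auto
  then have "((\<lambda>x. x \<bullet> (A *v x) + b \<bullet> x + c) has_derivative
      (\<lambda>h. x \<bullet> (A *v h) + h \<bullet> (A *v x) + b \<bullet> h)) (at x)"
    by (auto intro!: derivative_eq_intros)
  moreover have "x \<bullet> (A *v h) + h \<bullet> (A *v x) + b \<bullet> h = h \<bullet> ((A + transpose A) *v x + b)" for h
    by (simp add: dot_lmul_matrix[symmetric] matrix_vector_mult_add_rdistrib inner_add_right
        inner_commute transpose_matrix_vector)
  ultimately show ?thesis
    by (simp add: gderiv_def)
qed

lemma grad_eqI:
  assumes D: "GDERIV f x :> D"
  shows "grad f x = D"
  unfolding grad_def
proof (rule the_equality, rule D)
  fix D' assume "GDERIV f x :> D'"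
  then have "(\<lambda>h. h \<bullet> D') = (\<lambda>h. h \<bullet> D)"
    using D unfolding gderiv_def by (rule has_derivative_unique)
  then have "(D' - D) \<bullet> (D' - D) = 0"
    by (metis inner_diff_right right_minus_eq)
  then show "D' = D" by simp
qed

text \<open>The gradient is affine with the Hessian as its linear part, and it vanishes at the minimizer.\<close>

lemma quadratic_gradient:
  fixes f :: "real^'n \<Rightarrow> real"
  assumes "quadratic_function f" and min: "is_arg_min f (\<lambda>_. True) xstar"
  shows "transpose (hessian f xstar) = hessian f xstar"
    and "grad f x = hessian f xstar *v (x - xstar)"
proof -
  obtain A b c where f: "f = (\<lambda>x. x \<bullet> (A *v x) + b \<bullet> x + c)"
    using assms(1) unfolding quadratic_function_def by blast
  let ?G = "A + transpose A"
  have gderiv: "GDERIV f x :> ?G *v x + b" for x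
    unfolding f by (rule GDERIV_quadratic)
  then have grad: "grad f = (\<lambda>x. ?G *v x + b)"
    using grad_eqI by blast
  have "((\<lambda>x. ?G *v x + b) has_derivative (*v) ?G) (at xstar)"
    by (auto intro!: derivative_eq_intros linear_imp_has_derivative)
  then have "frechet_derivative (grad f) (at xstar) = (*v) ?G"
    unfolding grad using frechet_derivative_at by metis
  then have hess: "hessian f xstar = ?G"
    by (simp add: hessian_def jacobian_def)
  show "transpose (hessian f xstar) = hessian f xstar"
    unfolding hess by (simp add: transpose_def vec_eq_iff)
  have "(f has_derivative (\<lambda>h. h \<bullet> (?G *v xstar + b))) (at xstar)"
    using gderiv by (simp add: gderiv_def)
  moreover have "f xstar \<le> f y" for y
    using min by (auto simp: is_arg_min_def not_less)
  ultimately have "(\<lambda>h. h \<bullet> (?G *v xstar + b)) = (\<lambda>h. 0)"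
    by (intro has_derivative_local_min) auto
  then have "?G *v xstar + b = 0"
    by (metis inner_eq_zero_iff)
  then show "grad f x = hessian f xstar *v (x - xstar)"
    unfolding hess grad
    by (simp add: matrix_vector_mult_diff_distrib eq_neg_iff_add_eq_0[symmetric])
qed

text \<open>Translating the minimizer to the origin turns the method into the linear recursion.\<close>

lemma heavy_ball_error:
  assumes A: "linear A" and grad: "\<And>x. grad f x = A (x - xstar)"
  shows "heavy_ball \<alpha> \<beta> f x0 k - xstar = error_iterate \<alpha> \<beta> A k (x0 - xstar)"
proof (induction k rule: less_induct)
  case (less k)
  show ?case
  proof (cases k)
    case (Suc j)
    have IH: "heavy_ball \<alpha> \<beta> f x0 j = xstar + error_iterate \<alpha> \<beta> A j (x0 - xstar)"
      "heavy_ball \<alpha> \<beta> f x0 (j - 1) = xstar + error_iterate \<alpha> \<beta> A (j - 1) (x0 - xstar)"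
      using less[of j] less[of "j - 1"] Suc by (auto simp: algebra_simps)
    then show ?thesis
      unfolding Suc heavy_ball.simps error_iterate.simps grad IH by simp
  qed simp
qed

theorem theorem1:
  fixes f :: "real^'n \<Rightarrow> real"
    and xstar x0 :: "real^'n"
    and H :: "real^'n^'n"
    and m M \<kappa> \<alpha> \<beta> \<epsilon> :: real
    and k :: nat
    and x :: "nat \<Rightarrow> real^'n"
  assumes "quadratic_function f"
    and "strictly_convex_on UNIV f"
    and "is_arg_min f (\<lambda>_. True) xstar"
    and "H = hessian f xstar"
    and "\<And>l. eigenvalue H l \<Longrightarrow> l \<le> M"
    and "m > 0"
    and "\<And>l. eigenvalue H l \<Longrightarrow> m \<le> l"
    and "\<kappa> = M / m"
    and "\<kappa> \<ge> 28"
    and "\<alpha> = 2 / M"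
    and "\<beta> = (1 - sqrt (2 / \<kappa>))\<^sup>2"
    and "0 < \<epsilon>"
    and "\<epsilon> \<le> 1 / \<kappa>"
    and "x = heavy_ball \<alpha> \<beta> f x0"
    and "k = 1 + nat \<lceil>sqrt (2 * \<kappa>) * ln (2 / \<epsilon>)\<rceil>"
  shows "norm ((1 / 2) *\<^sub>R (x (k - 1) + x k) - xstar) \<le> \<epsilon> * norm (x0 - xstar)"
proof -
  define q where "q = sqrt (2 / \<kappa>)"
  \<comment> \<open>The averaged iterates are those with indices \<open>n\<close> and \<open>n + 1\<close>.\<close>
  define n where "n = k - 1"
  let ?E = "error_iterate \<alpha> \<beta> ((*v) H)"
  have \<beta>: "\<beta> = (1 - q)\<^sup>2"
    by (simp add: assms(11) q_def)
  have k: "k = Suc n"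
    using assms(15) by (simp add: n_def)
  have q2: "q\<^sup>2 = 2 / \<kappa>" and "0 < q"
    using assms(9) by (auto simp: q_def)
  have "q\<^sup>2 \<le> (1 / 2)\<^sup>2"
    using assms(9) by (simp add: q2 field_simps)
  then have "q \<le> 1 / 2"
    by (rule power2_le_imp_le) simp
  have "2 / q = sqrt (2 * \<kappa>)"
  proof (rule real_sqrt_unique[symmetric])
    show "(2 / q)\<^sup>2 = 2 * \<kappa>"
      using assms(9) by (simp add: power_divide q2)
  qed (use \<open>0 < q\<close> in simp)
  then have n: "n = nat \<lceil>(2 / q) * ln (2 / \<epsilon>)\<rceil>"
    using assms(15) by (simp add: n_def)
  have "1 / \<kappa> \<le> 1"
    using assms(9) by simp
  then have "\<epsilon> \<le> 1"
    using assms(13) by simp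
  have "0 < M"
    using assms(6,8,9) by (auto simp: field_simps zero_less_divide_iff)
  have lin: "linear ((*v) H)"
    by simp
  have adj: "(H *v u) \<bullet> v = u \<bullet> (H *v v)" for u v
    using quadratic_gradient(1)[OF assms(1,3)] assms(4)
    by (metis dot_lmul_matrix transpose_matrix_vector)
  \<comment> \<open>The characteristic roots are complex, or double, for every eigenvalue.\<close>
  have eig: "(1 - (1 - q))\<^sup>2 \<le> \<alpha> * l \<and> \<alpha> * l \<le> (1 + (1 - q))\<^sup>2"
    if "w \<noteq> 0" "H *v w = l *\<^sub>R w" for w l
  proof
    have "eigenvalue H l"
      using that by (auto simp: eigenvalue_def)
    then have l: "m \<le> l" "l \<le> M"
      using assms(5,7) by auto
    show "(1 - (1 - q))\<^sup>2 \<le> \<alpha> * l"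
      using l(1) \<open>0 < M\<close> assms(6) by (simp add: q2 assms(8,10) field_simps)
    have "\<alpha> * l \<le> 2"
      using l(2) \<open>0 < M\<close> by (simp add: assms(10) field_simps)
    also have "2 \<le> (3 / 2 :: real)\<^sup>2"
      by (simp add: power2_eq_square)
    also have "\<dots> \<le> (1 + (1 - q))\<^sup>2"
      using \<open>q \<le> 1 / 2\<close> by (intro power_mono) auto
    finally show "\<alpha> * l \<le> (1 + (1 - q))\<^sup>2" .
  qed
  have err: "x j - xstar = ?E j (x0 - xstar)" for j
    unfolding assms(14) using lin
    by (rule heavy_ball_error) (simp add: assms(4) quadratic_gradient(2)[OF assms(1,3)])
  have "(1 / 2) *\<^sub>R (x (k - 1) + x k) - xstar
      = (1 / 2) *\<^sub>R ((x n - xstar) + (x (Suc n) - xstar))"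
    by (simp add: k vec_eq_iff field_simps)
  also have "norm \<dots> \<le> (1 - q) ^ n * ((1 - q) + (1 - (1 - q)\<^sup>2) * real (Suc n) / 2)
      * norm (x0 - xstar)"
    unfolding err \<beta>
    by (rule norm_average_error_iterate_le[OF lin adj eig])
      (use \<open>0 < q\<close> \<open>q \<le> 1 / 2\<close> in auto)
  also have "\<dots> \<le> \<epsilon> * norm (x0 - xstar)"
    using decay_at_step_count[OF _ _ assms(12) \<open>\<epsilon> \<le> 1\<close> n] \<open>0 < q\<close> \<open>q \<le> 1 / 2\<close>
    by (intro mult_right_mono) auto
  finally show ?thesis .
qed

end
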